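(* For all integers $n,k,i,j\ge 0$ let $\overline{C}_3(n;k;i,j)$ denote the number of jagged overpartitions of $n$ (as defined in the context) with exactly $k$ non-overlined parts, exactly $i$ parts of color $a$ and exactly $j$ parts of color $b$, satisfying the additional condition that the final $t$ parts are overlined, where $t$ is the number of parts of color $u$. Then, as formal power series, $$\sum_{n,k,i,j \geq 0} \overline{C}_3(n;k;i,j) a^ib^jd^kq^n = (-q;q)_{\infty} \sum_{r,s \geq 0} \frac{q^{r^2+r+s^2+s - \binom{r+s+1}{2}} a^rb^s d^{r+s} (-q/d;q)_{r+s}}{(q^2;q^2)_r(q^2;q^2)_s}.$$
   Context: Notation: $(x;q)_n=\prod_{m=0}^{n-1}(1-xq^m)$ for $n\in\mathbb{N}\cup\{\infty\}$. A jagged overpartition of $n$ is a finite sequence $(\lambda_1,\dots,\lambda_s)$ of non-negative integers with sum $n$, where each part carries one of three colors $a$, $b$, $u$, the final occurrence of a positive part may be overlined (zero parts are never overlined), the last part satisfies $\lambda_s\notin\{0_a,0_b,\overline{1}_a,\overline{1}_b\}$, and for each $i$ the difference $\lambda_i-\lambda_{i+1}$ is at least the entry of the following matrix in the row given by the type of $\lambda_i$ and the column given by the type of $\lambda_{i+1}$ (types: $\overline{a},\overline{b},\overline{u}$ for overlined parts of colors $a,b,u$; $a,b,u$ for non-overlined ones), columns in the order $\overline{a},\overline{b},\overline{u},a,b,u$: row $\overline{a}$: $2,0,2,2,0,2$; row $\overline{b}$: $2,2,3,2,2,3$; row $\overline{u}$: $1,0,1,1,0,1$; row $a$: $1,-1,1,1,-1,1$;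 row $b$: $1,1,2,1,1,2$; row $u$: $0,-1,0,0,-1,0$. Non-overlined parts include parts equal to $0$. *)

theory Defs
  imports
    "HOL-Complex_Analysis.Laurent_Convergence"
begin

section \<open>Jagged overpartitions\<close>

datatype colour = A | B | U

datatype part = Part (val: nat) (colour: colour) (overlined: bool)

fun type_index :: "part \<Rightarrow> nat" where
  "type_index (Part _ A True) = 0"
| "type_index (Part _ B True) = 1"
| "type_index (Part _ U True) = 2"
| "type_index (Part _ A False) = 3"
| "type_index (Part _ B False) = 4"
| "type_index (Part _ U False) = 5"

definition diff_matrix :: "int list list" where
  "diff_matrix =
    [[2,  0, 2, 2,  0, 2],
     [2,  2, 3, 2,  2, 3],
     [1,  0, 1, 1,  0, 1],
     [1, -1, 1, 1, -1, 1],
     [1,  1, 2, 1,  1, 2],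
     [0, -1, 0, 0, -1, 0]]"

definition min_diff :: "part \<Rightarrow> part \<Rightarrow> int" where
  "min_diff p p' = diff_matrix ! type_index p ! type_index p'"

text \<open>
  Parts are coloured integers, so an occurrence of a part is an entry with the same value
  \<^emph>\<open>and\<close> the same colour; only the last of these may be overlined.  The empty sequence is the
  jagged overpartition of 0 without parts.
\<close>

definition jagged_overpartition :: "nat \<Rightarrow> part list \<Rightarrow> bool" where
  "jagged_overpartition n ps \<longleftrightarrow>
     sum_list (map val ps) = n \<and>
     (\<forall>p \<in> set ps. overlined p \<longrightarrow> val p > 0) \<and>
     (\<forall>i j. i < j \<and> j < length ps \<and> overlined (ps ! i) \<longrightarrow>
        \<not> (val (ps ! i) = val (ps ! j) \<and> colour (ps ! i) = colour (ps ! j))) \<and>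
     (ps \<noteq> [] \<longrightarrow>
        last ps \<notin> {Part 0 A False, Part 0 B False, Part 1 A True, Part 1 B True}) \<and>
     (\<forall>i. Suc i < length ps \<longrightarrow>
        int (val (ps ! i)) - int (val (ps ! Suc i)) \<ge> min_diff (ps ! i) (ps ! Suc i))"

definition num_colour :: "colour \<Rightarrow> part list \<Rightarrow> nat" where
  "num_colour c ps = length (filter (\<lambda>p. colour p = c) ps)"

definition num_nonoverlined :: "part list \<Rightarrow> nat" where
  "num_nonoverlined ps = length (filter (\<lambda>p. \<not> overlined p) ps)"

definition C3_set :: "nat \<Rightarrow> nat \<Rightarrow> nat \<Rightarrow> nat \<Rightarrow> part list set" where
  "C3_set n k i j =
     {ps. jagged_overpartition n ps \<and> num_nonoverlined ps = k \<and>
          num_colour A ps = i \<and> num_colour B ps = j \<and>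
          (\<forall>p \<in> set (drop (length ps - num_colour U ps) ps). overlined p)}"

definition C3 :: "nat \<Rightarrow> nat \<Rightarrow> nat \<Rightarrow> nat \<Rightarrow> nat" where
  "C3 n k i j = card (C3_set n k i j)"

text \<open>The cardinality above is never that of an infinite set.\<close>

lemma finite_C3_set: "finite (C3_set n k i j)"
proof -
  let ?P = "{p. val p \<le> n}"
  have "?P = (\<lambda>(v, c, b). Part v c b) ` ({..n} \<times> UNIV \<times> UNIV)"
  proof (intro equalityI subsetI)
    fix p assume "p \<in> ?P"
    then have "p = (\<lambda>(v, c, b). Part v c b) (val p, colour p, overlined p)"
      and "(val p, colour p, overlined p) \<in> {..n} \<times> UNIV \<times> UNIV"
      by simp_all
    then show "p \<in> (\<lambda>(v, c, b). Part v c b) ` ({..n} \<times> UNIV \<times> UNIV)"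
      by (rule image_eqI)
  qed auto
  moreover have "finite (UNIV :: colour set)"
  proof (rule finite_subset)
    show "(UNIV :: colour set) \<subseteq> {A, B, U}"
      using colour.exhaust by blast
  qed simp
  moreover have "finite (UNIV :: bool set)"
    by simp
  ultimately have fin: "finite ?P"
    by (simp only: finite_imageI finite_cartesian_product finite_atMost)
  have "C3_set n k i j \<subseteq> {ps. set ps \<subseteq> ?P \<and> length ps \<le> n + k}"
  proof
    fix ps assume "ps \<in> C3_set n k i j"
    then have s: "sum_list (map val ps) = n" and pos: "\<forall>p\<in>set ps. overlined p \<longrightarrow> val p > 0"
      and k: "num_nonoverlined ps = k"
      by (auto simp: C3_set_def jagged_overpartition_def)
    have "length ps \<le> sum_list (map val ps) + num_nonoverlined ps"
      using pos
    proof (induction ps)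
      case (Cons p ps)
      then show ?case
        by (cases "overlined p") (simp_all add: num_nonoverlined_def)
    qed simp
    moreover have "set ps \<subseteq> ?P"
      using s member_le_sum_list[of _ "map val ps"] by auto
    ultimately show "ps \<in> {ps. set ps \<subseteq> ?P \<and> length ps \<le> n + k}"
      using s k by simp
  qed
  then show ?thesis
    by (rule finite_subset) (rule finite_lists_length_le[OF fin])
qed


section \<open>$q$-Pochhammer symbols\<close>

definition qpoch :: "'a::comm_ring_1 \<Rightarrow> 'a \<Rightarrow> nat \<Rightarrow> 'a" where
  "qpoch x q n = (\<Prod>m<n. 1 - x * q ^ m)"

definition qpoch_inf :: "'a::{t2_space, comm_ring_1} \<Rightarrow> 'a \<Rightarrow> 'a" where
  "qpoch_inf x q = (\<Prod>m. 1 - x * q ^ m)"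

text \<open>In the topology of formal power series, $(-q;q)_\infty$ does converge.\<close>

lemma has_prod_qpoch_inf:
  "(\<lambda>m. 1 - (- fps_X) * fps_X ^ m) has_prod qpoch_inf (- fps_X) (fps_X :: rat fps)"
proof -
  define f :: "nat \<Rightarrow> rat fps" where "f = (\<lambda>m. 1 - (- fps_X) * fps_X ^ m)"
  define P where "P n = (\<Prod>i\<le>n. f i)" for n
  define L where "L = Abs_fps (\<lambda>n. fps_nth (P n) n)"
  have P_Suc: "P (Suc m) = P m + P m * fps_X ^ Suc (Suc m)" for m
    by (simp add: P_def f_def algebra_simps)
  have stable: "fps_nth (P m) n = fps_nth (P n) n" if "n \<le> m" for m n
    using that
  proof (induction m rule: dec_induct)
    case (step m)
    have "fps_nth (P m * fps_X ^ Suc (Suc m)) n = 0"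
      using step.hyps by (subst fps_X_power_mult_right_nth) auto
    then show ?case
      using step.IH by (simp only: P_Suc fps_add_nth)
  qed simp
  have "P \<longlonglongrightarrow> L"
  proof (rule tendsto_fpsI)
    fix n show "\<forall>\<^sub>F m in sequentially. fps_nth (P m) n = fps_nth L n"
    using eventually_ge_at_top[of n]
    proof eventually_elim
      case (elim m)
      then show ?case
        unfolding L_def fps_nth_Abs_fps by (rule stable)
    qed
  qed
  moreover have "fps_nth L 0 = 1"
    by (simp add: L_def P_def f_def)
  then have "L \<noteq> 0"
    by auto
  ultimately have "raw_has_prod f 0 L"
    unfolding raw_has_prod_def P_def[abs_def] by simp
  then have "f has_prod L"
    unfolding has_prod_def by blast
  then have "f has_prod (\<Prod>m. f m)"
    using has_prod_unique by metis
  then show ?thesis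
    unfolding f_def qpoch_inf_def .
qed


section \<open>Formal power series in several variables\<close>

text \<open>
  \<open>series2 F\<close> is the formal power series $\sum_{i,j \ge 0} F_{i,j}\, x^i y^j$ in two variables
  (\<open>x\<close> the outer one, \<open>y\<close> the inner one) with coefficients \<open>F i j\<close>.
\<close>

definition series2 :: "(nat \<Rightarrow> nat \<Rightarrow> 'a) \<Rightarrow> 'a fps fps" where
  "series2 F = Abs_fps (\<lambda>i. Abs_fps (\<lambda>j. F i j))"

text \<open>
  Because of the subterm $q/d$, four-variable series are elements of
  $\mathbb{Q}[[q]]((d))[[b]][[a]]$, i.e. of the type \<open>abdq_series\<close>.  It contains
  $\mathbb{Q}[[a,b,d,q]]$, the embedding being \<open>fps_to_fls\<close> on the coefficients of the
  $a^i b^j$.  In $\mathbb{Q}[[q]]((d))$ the elements \<open>q\<close>, \<open>d\<close> and $1/d$ are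
  \<open>fls_const fps_X\<close>, \<open>fls_X\<close> and \<open>fls_X_inv\<close>.
\<close>

type_synonym abdq_series = "rat fps fls fps fps"

text \<open>The exponent of \<open>q\<close> in the double sum involves no truncated subtraction.\<close>

lemma choose_two_le: "(r + s + 1 choose 2) \<le> r\<^sup>2 + r + s\<^sup>2 + s"
proof -
  have "2 * real r * real s \<le> (real r)\<^sup>2 + (real s)\<^sup>2"
    by (rule sum_squares_bound)
  then have "real (2 * r * s) \<le> real (r\<^sup>2 + s\<^sup>2)"
    by simp
  then have "(r + s + 1) * (r + s) \<le> 2 * (r\<^sup>2 + r + s\<^sup>2 + s)"
    unfolding of_nat_le_iff by (simp add: power2_eq_square algebra_simps)
  then show ?thesis
    by (simp add: choose_two)
qed

end

theory Submission
  imports Defs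
begin

text \<open>
  Overlining a part raises all its difference conditions by 1, and the condition that only final
  occurrences are overlined then holds automatically.  So the sequences with \<open>i\<close>, \<open>j\<close>, \<open>t\<close> parts
  of colour \<open>a\<close>, \<open>b\<close>, \<open>u\<close> amount to a word in the colours together with arbitrary slacks and a
  set of overlined positions.  Removing the last part gives a linear recurrence between the
  generating functions with prescribed next colour, whose solution for the actual end condition
  is \<open>(-q;q)\<^sub>N q\<^sup>E \<Prod>\<^sub>m (d + q\<^sup>m) / ((q\<^sup>2;q\<^sup>2)\<^sub>i (q\<^sup>2;q\<^sup>2)\<^sub>j)\<close> times \<open>q\<^bsup>Nt + t(t+1)/2\<^esup> / (q;q)\<^sub>t\<close>,
  where \<open>N = i + j\<close> and \<open>m\<close> runs from 1 to \<open>N\<close>.  The sum over \<open>t\<close> is Euler's expansion of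
  \<open>(-q\<^bsup>N+1\<^esup>;q)\<^sub>\<infinity>\<close>.
\<close>

section \<open>The closed form of the recurrence\<close>

text \<open>The exponent of q in the double sum. Over the rationals it equals
  \<open>((i - j)\<^sup>2 + i + j) / 2\<close>.\<close>

definition expo :: "nat \<Rightarrow> nat \<Rightarrow> nat" where
  "expo i j = i\<^sup>2 + i + j\<^sup>2 + j - (i + j + 1 choose 2)"

lemma two_expo: "2 * expo i j + 2 * i * j = i\<^sup>2 + i + j\<^sup>2 + j"
proof -
  have "2 * (i + j + 1 choose 2) = (i + j + 1) * (i + j)"
    by (simp add: choose_two)
  then show ?thesis
    using choose_two_le[of i j] by (simp add: expo_def power2_eq_square algebra_simps)
qed

lemma expo_commute: "expo i j = expo j i"
  by (simp add: expo_def add_ac)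

text \<open>Raising i by 1 changes the exponent by \<open>i + 1 - j\<close>, which may be negative;
  hence a term is added on each side.\<close>

lemma expo_Suc: "expo i j + Suc i = expo (Suc i) j + j"
  using two_expo[of i j] two_expo[of "Suc i" j] by (simp add: power2_eq_square algebra_simps)

lemma power_expo_Suc_left:
  "q ^ Suc i * q ^ expo i j = q ^ j * (q ^ expo (Suc i) j :: 'a::comm_monoid_mult)"
  using expo_Suc[of i j] by (metis power_add add.commute)

lemma qpoch_0 [simp]: "qpoch x q 0 = 1"
  by (simp add: qpoch_def)

lemma qpoch_Suc: "qpoch x q (Suc n) = qpoch x q n * (1 - x * q ^ n)"
  by (simp add: qpoch_def)

lemma qpoch_minus_Suc: "qpoch (- q) q (Suc n) = qpoch (- q) q n * (1 + q ^ Suc n)"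
  by (simp add: qpoch_Suc)

lemma qpoch_power_Suc:
  "qpoch (q\<^sup>2) (q\<^sup>2) (Suc n) = qpoch (q\<^sup>2) (q\<^sup>2) n * (1 - (q ^ Suc n)\<^sup>2)"
proof -
  have "q\<^sup>2 * (q\<^sup>2) ^ n = (q ^ Suc n)\<^sup>2"
    by (metis power_Suc power_mult mult.commute)
  then show ?thesis
    by (simp only: qpoch_Suc)
qed

text \<open>
  \<open>FA\<close>, \<open>FB\<close>, \<open>FU\<close> are generating functions of sequences followed by a part of the respective
  colour; the recurrences remove the last part, at position \<open>i + j + t\<close>.  The closed forms are
  cleared of denominators in order to make sense in any integral domain.
\<close>

theorem word_recurrence_closed_form:
  fixes q :: "'a::idom" and h :: "nat \<Rightarrow> 'a" and FA FB FU :: "nat \<Rightarrow> nat \<Rightarrow> nat \<Rightarrow> 'a"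
  defines "D \<equiv> \<lambda>i j t. qpoch q q t * qpoch (q\<^sup>2) (q\<^sup>2) i * qpoch (q\<^sup>2) (q\<^sup>2) j"
  defines "V \<equiv> \<lambda>i j t. q ^ expo i j * qpoch (- q) q (i + j) * (\<Prod>m<i + j + t. h m)"
  defines "TA \<equiv> \<lambda>i j t. if i = 0 then 0 else FA (i - 1) j t"
  defines "TB \<equiv> \<lambda>i j t. if j = 0 then 0 else FB i (j - 1) t"
  defines "TU \<equiv> \<lambda>i j t. if t = 0 then 0 else FU i j (t - 1)"
  assumes q0: "q \<noteq> 0" and q1: "\<And>n. n > 0 \<Longrightarrow> q ^ n \<noteq> 1" and qm1: "\<And>n. 1 + q ^ n \<noteq> 0"
  assumes base: "FA 0 0 0 = 1" "FB 0 0 0 = 1" "FU 0 0 0 = 1"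
  assumes recA: "\<And>i j t. i + j + t > 0 \<Longrightarrow> (1 - q ^ (i + j + t)) * FA i j t =
      h (i + j + t - 1) * (q ^ (i + j + t) * TA i j t + TB i j t + TU i j t)"
  assumes recB: "\<And>i j t. i + j + t > 0 \<Longrightarrow> (1 - q ^ (i + j + t)) * FB i j t =
      h (i + j + t - 1) * (TA i j t + q ^ (i + j + t) * TB i j t + TU i j t)"
  assumes recU: "\<And>i j t. i + j + t > 0 \<Longrightarrow> (1 - q ^ (i + j + t)) * FU i j t =
      h (i + j + t - 1) * (q ^ (i + j + t) * TA i j t + q ^ (i + j + t) * TB i j t + TU i j t)"
  shows "D i j t * q ^ j * FA i j t = V i j t \<and> D i j t * q ^ i * FB i j t = V i j t \<and>
    (1 + q ^ (i + j)) * D i j t * FU i j t = (q ^ i + q ^ j) * V i j t"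
proof (induction "i + j + t" arbitrary: i j t)
  case 0
  then show ?case
    by (simp add: D_def V_def base expo_def)
next
  case (Suc n)
  \<comment> \<open>In these powers of \<open>q\<close> the induction step becomes a set of
    polynomial identities.\<close>
  define X Y T where "X = q ^ i" and "Y = q ^ j" and "T = q ^ t"
  define W where "W = q ^ expo i j * qpoch (- q) q (i + j) * (\<Prod>m<n. h m)"
  define d where "d = D i j t"
  have XYT: "q ^ (i + j + t) = X * Y * T"
    by (simp add: X_def Y_def T_def power_add)
  have XY: "q ^ (i + j) = X * Y"
    by (simp add: X_def Y_def power_add)
  have X0: "X \<noteq> 0" and Y0: "Y \<noteq> 0"
    using q0 by (simp_all add: X_def Y_def)
  have L0: "1 - X * Y * T \<noteq> 0"
  proof -
    have "i + j + t > 0"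
      using Suc.hyps(2) by linarith
    from q1[OF this] show ?thesis
      by (simp add: XYT)
  qed
  have P0: "1 + X * Y \<noteq> 0"
    using qm1[of "i + j"] by (simp add: XY)
  have Veq: "V i j t = W * h n"
    by (simp add: V_def W_def Suc.hyps(2)[symmetric])
  \<comment> \<open>The induction hypothesis for one part of colour a fewer, free of division. For i
    = 0 both sides vanish, the right one because X = 1.\<close>
  have a: "(1 + X * Y) * X * d * TA i j t = (1 - X\<^sup>2) * W"
  proof (cases i)
    case 0
    then show ?thesis by (simp add: TA_def X_def)
  next
    case (Suc i')
    have IH: "D i' j t * Y * FA i' j t =
        q ^ expo i' j * qpoch (- q) q (i' + j) * (\<Prod>m<n. h m)"
      using Suc.hyps(1)[of i' j t] Suc.hyps(2) Suc by (simp add: V_def Y_def)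
    have dd: "d = D i' j t * (1 - X\<^sup>2)"
      by (simp only: d_def D_def Suc qpoch_power_Suc X_def mult_ac)
    have mm: "qpoch (- q) q (i + j) = qpoch (- q) q (i' + j) * (1 + X * Y)"
      using XY qpoch_minus_Suc[of q "i' + j"] by (simp add: Suc)
    have ee: "X * q ^ expo i' j = Y * q ^ expo i j"
      unfolding X_def Y_def Suc by (rule power_expo_Suc_left)
    \<comment> \<open>The extra factor Y is the one in \<open>IH\<close>; being nonzero, it cancels
      at the end.\<close>
    have "Y * ((1 + X * Y) * X * d * TA i j t) =
        (1 + X * Y) * X * (1 - X\<^sup>2) * (D i' j t * Y * FA i' j t)"
      by (simp add: TA_def Suc dd)
    also have "\<dots> = (1 - X\<^sup>2) * (X * q ^ expo i' j) * (qpoch (- q) q (i' + j) * (1 + X * Y))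
        * (\<Prod>m<n. h m)"
      unfolding IH by (simp only: mult_ac)
    also have "\<dots> = Y * ((1 - X\<^sup>2) * W)"
      unfolding ee mm[symmetric] W_def by (simp only: mult_ac)
    finally show ?thesis
      using Y0 by simp
  qed
  have b: "(1 + X * Y) * Y * d * TB i j t = (1 - Y\<^sup>2) * W"
  proof (cases j)
    case 0
    then show ?thesis by (simp add: TB_def Y_def)
  next
    case (Suc j')
    have IH: "D i j' t * X * FB i j' t =
        q ^ expo i j' * qpoch (- q) q (i + j') * (\<Prod>m<n. h m)"
      using Suc.hyps(1)[of i j' t] Suc.hyps(2) Suc by (simp add: V_def X_def)
    have dd: "d = D i j' t * (1 - Y\<^sup>2)"
      by (simp only: d_def D_def Suc qpoch_power_Suc Y_def mult_ac)
    have mm: "qpoch (- q) q (i + j) = qpoch (- q) q (i + j') * (1 + X * Y)"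
      using XY qpoch_minus_Suc[of q "i + j'"] by (simp add: Suc)
    have ee: "Y * q ^ expo i j' = X * q ^ expo i j"
      unfolding X_def Y_def Suc expo_commute[of i] by (rule power_expo_Suc_left)
    have "X * ((1 + X * Y) * Y * d * TB i j t) =
        (1 + X * Y) * Y * (1 - Y\<^sup>2) * (D i j' t * X * FB i j' t)"
      by (simp add: TB_def Suc dd)
    also have "\<dots> = (1 - Y\<^sup>2) * (Y * q ^ expo i j') * (qpoch (- q) q (i + j') * (1 + X * Y))
        * (\<Prod>m<n. h m)"
      unfolding IH by (simp only: mult_ac)
    also have "\<dots> = X * ((1 - Y\<^sup>2) * W)"
      unfolding ee mm[symmetric] W_def by (simp only: mult_ac)
    finally show ?thesis
      using X0 by simp
  qed
  have u: "(1 + X * Y) * d * TU i j t = (1 - T) * (X + Y) * W"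
  proof (cases t)
    case 0
    then show ?thesis by (simp add: TU_def T_def)
  next
    case (Suc t')
    have IH: "(1 + X * Y) * D i j t' * FU i j t' = (X + Y) * W"
      using Suc.hyps(1)[of i j t'] Suc.hyps(2) Suc
      by (simp add: V_def X_def Y_def W_def power_add)
    have "d = D i j t' * (1 - T)"
      by (simp add: d_def D_def Suc qpoch_Suc T_def)
    then have "(1 + X * Y) * d * TU i j t = (1 - T) * ((1 + X * Y) * D i j t' * FU i j t')"
      by (simp add: TU_def Suc)
    then show ?thesis
      by (simp add: IH)
  qed
  have rA: "(1 - X * Y * T) * FA i j t = h n * (X * Y * T * TA i j t + TB i j t + TU i j t)"
    and rB: "(1 - X * Y * T) * FB i j t = h n * (TA i j t + X * Y * T * TB i j t + TU i j t)"
    and rU: "(1 - X * Y * T) * FU i j t =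
      h n * (X * Y * T * TA i j t + X * Y * T * TB i j t + TU i j t)"
    using recA[of i j t] recB[of i j t] recU[of i j t] Suc.hyps(2)[symmetric] XYT by simp_all
  have "(1 + X * Y) * (1 - X * Y * T) * (d * Y * FA i j t) =
      (1 + X * Y) * d * Y * ((1 - X * Y * T) * FA i j t)"
    by (simp only: mult_ac)
  also have "\<dots> = h n * (Y\<^sup>2 * T * ((1 + X * Y) * X * d * TA i j t) + (1 + X * Y) * Y * d * TB i j t
      + Y * ((1 + X * Y) * d * TU i j t))"
    unfolding rA by algebra
  \<comment> \<open>Up to the factor \<open>W * h n\<close> this is \<open>Y\<^sup>2 * T * (1 -
    X\<^sup>2) + (1 - Y\<^sup>2) + Y * (1 - T) * (X + Y) = (1 + X * Y) * (1 - X * Y *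
    T)\<close>.\<close>
  also have "\<dots> = (1 + X * Y) * (1 - X * Y * T) * (W * h n)"
    unfolding a b u by algebra
  finally have A: "d * Y * FA i j t = V i j t"
    using L0 P0 by (simp add: Veq)
  have "(1 + X * Y) * (1 - X * Y * T) * (d * X * FB i j t) =
      (1 + X * Y) * d * X * ((1 - X * Y * T) * FB i j t)"
    by (simp only: mult_ac)
  also have "\<dots> = h n * ((1 + X * Y) * X * d * TA i j t + X\<^sup>2 * T * ((1 + X * Y) * Y * d * TB i j t)
      + X * ((1 + X * Y) * d * TU i j t))"
    unfolding rB by algebra
  also have "\<dots> = (1 + X * Y) * (1 - X * Y * T) * (W * h n)"
    unfolding a b u by algebra
  finally have B: "d * X * FB i j t = V i j t"
    using L0 P0 by (simp add: Veq)
  have "(1 - X * Y * T) * ((1 + X * Y) * d * FU i j t) =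
      (1 + X * Y) * d * ((1 - X * Y * T) * FU i j t)"
    by (simp only: mult_ac)
  also have "\<dots> = h n * (Y * T * ((1 + X * Y) * X * d * TA i j t)
      + X * T * ((1 + X * Y) * Y * d * TB i j t) + (1 + X * Y) * d * TU i j t)"
    unfolding rU by algebra
  \<comment> \<open>Here the three terms sum to a multiple of \<open>X + Y\<close> without the
    factor \<open>1 + X * Y\<close>, which therefore stays in the claim for
    \<open>FU\<close>.\<close>
  also have "\<dots> = (1 - X * Y * T) * ((X + Y) * (W * h n))"
    unfolding a b u by algebra
  finally have U: "(1 + X * Y) * d * FU i j t = (X + Y) * V i j t"
    using L0 by (simp add: Veq)
  show ?case
    using A B U by (simp add: X_def Y_def d_def XY power_add)
qed


section \<open>Euler's identity\<close>

text \<open>The term of index t in Euler's expansion of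
  \<open>(-q^(N+1);q)_\<infinity>\<close>.\<close>

definition euler_term :: "nat \<Rightarrow> nat \<Rightarrow> rat fps" where
  "euler_term N t = (\<Prod>m<t. fps_X ^ (N + Suc m)) * inverse (qpoch fps_X fps_X t)"

text \<open>The term of index t has order at least t, so only t \<le> n reaches the coefficient of
  \<open>q^n\<close>; this defines the infinite sum coefficientwise.\<close>

definition euler_sum :: "nat \<Rightarrow> rat fps" where
  "euler_sum N = Abs_fps (\<lambda>n. fps_nth (\<Sum>t<Suc n. euler_term N t) n)"

lemma fps_nth_qpoch_0: "fps_nth x 0 = 0 \<Longrightarrow> fps_nth (qpoch x q n) 0 = 1"
  by (induction n) (simp_all add: qpoch_Suc)

lemma fps_nth_qpoch_0' [simp]:
  "fps_nth (qpoch fps_X q n) 0 = 1" "fps_nth (qpoch (fps_X\<^sup>2) q n) 0 = 1"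
  by (rule fps_nth_qpoch_0; simp)+

lemma euler_term_nth_eq_0:
  assumes "n < t"
  shows "fps_nth (euler_term N t) n = 0"
proof -
  have "(\<Prod>m<t. fps_X ^ (N + Suc m)) = (fps_X ^ (\<Sum>m<t. N + Suc m) :: rat fps)"
    by (rule power_sum[symmetric])
  moreover have "(\<Sum>m<t. 1) \<le> (\<Sum>m<t. N + Suc m)"
    by (rule sum_mono) simp
  ultimately show ?thesis
    using assms by (simp add: euler_term_def fps_X_power_mult_nth)
qed

text \<open>For t > 0 the exponent of q contains the summand N + 1.\<close>

lemma euler_term_nth_eq_0':
  assumes "n \<le> N" "t > 0"
  shows "fps_nth (euler_term N t) n = 0"
proof -
  have "(\<Prod>m<t. fps_X ^ (N + Suc m)) = (fps_X ^ (\<Sum>m<t. N + Suc m) :: rat fps)"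
    by (rule power_sum[symmetric])
  moreover have "N + Suc 0 \<le> (\<Sum>m<t. N + Suc m)"
    using assms by (intro member_le_sum) auto
  ultimately show ?thesis
    using assms by (simp add: euler_term_def fps_X_power_mult_nth)
qed

lemma euler_sum_nth:
  assumes "n < M"
  shows "fps_nth (\<Sum>t<M. euler_term N t) n = fps_nth (euler_sum N) n"
proof -
  have "(\<Sum>t<M. fps_nth (euler_term N t) n) = (\<Sum>t<Suc n. fps_nth (euler_term N t) n)"
    using assms by (intro sum.mono_neutral_right) (auto simp: euler_term_nth_eq_0)
  then show ?thesis
    by (simp add: euler_sum_def fps_sum_nth)
qed

text \<open>Split off the first factor of the product and write 1 as
  \<open>q^(t+1) + (1 - q^(t+1))\<close>: the first summand completes the product for N + 1, the
  second cancels the last factor of \<open>(q;q)_(t+1)\<close>.\<close>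

lemma euler_term_Suc:
  "euler_term N (Suc t) = euler_term (Suc N) (Suc t) + fps_X ^ Suc N * euler_term (Suc N) t"
proof -
  define Q where "Q = qpoch fps_X fps_X t * (1 - fps_X ^ Suc t :: rat fps)"
  have Q: "qpoch fps_X fps_X (Suc t) = Q"
    by (simp add: Q_def qpoch_Suc)
  define I where "I = (inverse Q :: rat fps)"
  have I: "I * (1 - fps_X ^ Suc t) = inverse (qpoch fps_X fps_X t)"
    by (simp add: I_def Q_def fps_inverse_mult mult.assoc inverse_mult_eq_1)
  have a: "(\<Prod>m<Suc t. fps_X ^ (N + Suc m)) =
      (fps_X ^ Suc N * (\<Prod>m<t. fps_X ^ (Suc N + Suc m)) :: rat fps)"
    by (subst prod.lessThan_Suc_shift) simp
  have b: "(\<Prod>m<Suc t. fps_X ^ (Suc N + Suc m)) =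
      (fps_X ^ Suc N * (\<Prod>m<t. fps_X ^ (Suc N + Suc m)) * fps_X ^ Suc t :: rat fps)"
    by (simp add: power_add mult_ac)
  show ?thesis
    unfolding euler_term_def a b Q I[symmetric] I_def[symmetric] by (simp add: algebra_simps)
qed

lemma euler_sum_Suc: "euler_sum N = (1 + fps_X ^ Suc N) * euler_sum (Suc N)"
proof (rule fps_ext)
  fix n
  have "(\<Sum>t<Suc M. euler_term N t) =
      (\<Sum>t<Suc M. euler_term (Suc N) t) + fps_X ^ Suc N * (\<Sum>t<M. euler_term (Suc N) t)" for M
  proof (induction M)
    case (Suc M)
    then show ?case
      using euler_term_Suc[of N M] by (simp add: algebra_simps del: power_Suc)
  qed (simp add: euler_term_def)
  \<comment> \<open>All truncations keep more than n terms, so their coefficients of index n are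
    those of the full sums.\<close>
  from this[of "Suc n"] have "fps_nth (euler_sum N) n = fps_nth (euler_sum (Suc N)) n +
      fps_nth (fps_X ^ Suc N * (\<Sum>t<Suc n. euler_term (Suc N) t)) n"
    using euler_sum_nth[of n "Suc (Suc n)"] by (metis fps_add_nth lessI less_SucI)
  also have "fps_nth (fps_X ^ Suc N * (\<Sum>t<Suc n. euler_term (Suc N) t)) n =
      fps_nth (fps_X ^ Suc N * euler_sum (Suc N)) n"
    by (simp only: fps_X_power_mult_nth) (simp only: euler_sum_nth less_Suc_eq_le diff_le_self)
  finally show "fps_nth (euler_sum N) n = fps_nth ((1 + fps_X ^ Suc N) * euler_sum (Suc N)) n"
    by (simp add: algebra_simps)
qed

lemma qpoch_times_euler_sum: "qpoch (- fps_X) fps_X N * euler_sum N = euler_sum 0"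
proof (induction N)
  case (Suc N)
  then show ?case
    by (simp only: qpoch_minus_Suc mult.assoc euler_sum_Suc[symmetric])
qed simp

text \<open>Up to order N only the term t = 0 survives. Hence \<open>euler_sum N\<close> tends to 1,
  which identifies \<open>euler_sum 0\<close> with the infinite product.\<close>

lemma euler_sum_nth_le:
  assumes "n \<le> N"
  shows "fps_nth (euler_sum N) n = (if n = 0 then 1 else 0)"
proof -
  have "(\<Sum>t<Suc n. fps_nth (euler_term N t) n) = (\<Sum>t\<in>{0}. fps_nth (euler_term N t) n)"
    using assms by (intro sum.mono_neutral_right) (auto simp: euler_term_nth_eq_0')
  then show ?thesis
    by (simp add: euler_sum_def fps_sum_nth euler_term_def)
qed

lemma qpoch_inf_eq_euler_sum: "qpoch_inf (- fps_X) fps_X = euler_sum 0"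
proof -
  define P where "P = (\<lambda>n. \<Prod>i\<le>n. 1 - (- fps_X) * fps_X ^ i :: rat fps)"
  have "P \<longlonglongrightarrow> qpoch_inf (- fps_X) fps_X"
    unfolding P_def by (rule has_prod_imp_tendsto[OF has_prod_qpoch_inf])
  moreover have "P \<longlonglongrightarrow> euler_sum 0"
  proof (rule tendsto_fpsI)
    fix n
    show "\<forall>\<^sub>F m in sequentially. fps_nth (P m) n = fps_nth (euler_sum 0) n"
      using eventually_ge_at_top[of n]
    proof eventually_elim
      case (elim m)
      have "P m = qpoch (- fps_X) fps_X (Suc m)"
        by (simp add: P_def qpoch_def lessThan_Suc_atMost)
      then have "fps_nth (euler_sum 0) n = fps_nth (P m * euler_sum (Suc m)) n"
        by (simp only: qpoch_times_euler_sum)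
      also have "\<dots> = (\<Sum>i=0..n. fps_nth (P m) i * (if n - i = 0 then 1 else 0))"
        using elim by (simp add: fps_mult_nth euler_sum_nth_le)
      also have "\<dots> = (\<Sum>i=0..n. if i = n then fps_nth (P m) i else 0)"
        by (intro sum.cong) auto
      also have "\<dots> = fps_nth (P m) n"
        by simp
      finally show ?case ..
    qed
  qed
  ultimately show ?thesis
    by (rule LIMSEQ_unique)
qed

text \<open>Coefficient n of a product uses only coefficients up to n of the first factor, and t
  \<le> n suffices for these.\<close>

lemma sum_euler_term_mult_nth:
  "fps_nth ((\<Sum>t\<le>n. euler_term N t) * w) n = fps_nth (euler_sum N * w) n"
  by (simp only: fps_mult_nth lessThan_Suc_atMost[symmetric])
    (intro sum.cong refl arg_cong2[of _ _ _ _ "(*)"] euler_sum_nth; simp)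


section \<open>Bivariate generating functions\<close>

text \<open>The outer variable plays the role of d, the inner one that of q.\<close>

definition gf :: "('a \<Rightarrow> nat) \<Rightarrow> ('a \<Rightarrow> nat) \<Rightarrow> 'a set \<Rightarrow> rat fps fps" where
  "gf f g S = series2 (\<lambda>k n. of_nat (card {x \<in> S. f x = k \<and> g x = n}))"

text \<open>As \<open>card\<close> is 0 on infinite sets, additivity of \<open>gf\<close> over
  disjoint unions rests on this condition.\<close>

definition finite_fibres :: "('a \<Rightarrow> nat) \<Rightarrow> 'a set \<Rightarrow> bool" where
  "finite_fibres g S \<longleftrightarrow> (\<forall>n. finite {x \<in> S. g x = n})"

lemma finite_fibres_subset: "finite_fibres g S \<Longrightarrow> T \<subseteq> S \<Longrightarrow> finite_fibres g T"
  unfolding finite_fibres_def by (blast intro: rev_finite_subset)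

lemma gf_nth: "fps_nth (fps_nth (gf f g S) k) n = of_nat (card {x \<in> S. f x = k \<and> g x = n})"
  by (simp add: gf_def series2_def)

lemma gf_UN:
  assumes "finite I" "\<And>i. i \<in> I \<Longrightarrow> finite_fibres g (S i)"
    and "\<And>i j. i \<in> I \<Longrightarrow> j \<in> I \<Longrightarrow> i \<noteq> j \<Longrightarrow> S i \<inter> S j = {}"
  shows "gf f g (\<Union>i\<in>I. S i) = (\<Sum>i\<in>I. gf f g (S i))"
proof (intro fps_ext)
  fix k n
  have "{x \<in> \<Union>i\<in>I. S i. f x = k \<and> g x = n} = (\<Union>i\<in>I. {x \<in> S i. f x = k \<and> g x = n})"
    by blast
  moreover have "finite {x \<in> S i. f x = k \<and> g x = n}" if "i \<in> I" for i
  proof (rule finite_subset)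
    show "finite {x \<in> S i. g x = n}"
      using assms(2)[OF that] by (simp add: finite_fibres_def)
  qed blast
  ultimately have "card {x \<in> \<Union>i\<in>I. S i. f x = k \<and> g x = n} =
      (\<Sum>i\<in>I. card {x \<in> S i. f x = k \<and> g x = n})"
    using assms(1,3) by (simp add: card_UN_disjoint disjoint_iff)
  then show "fps_nth (fps_nth (gf f g (\<Union>i\<in>I. S i)) k) n =
      fps_nth (fps_nth (\<Sum>i\<in>I. gf f g (S i)) k) n"
    by (simp add: gf_nth fps_sum_nth)
qed

lemma gf_Un:
  assumes "finite_fibres g S" "finite_fibres g T" "S \<inter> T = {}"
  shows "gf f g (S \<union> T) = gf f g S + gf f g T"
proof -
  have "(if b then T else S) \<inter> (if b' then T else S) = {}" if "b \<noteq> b'" for b b'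
    using that assms(3) by auto
  then have "gf f g (\<Union>b\<in>UNIV. if b then T else S) = (\<Sum>b\<in>UNIV. gf f g (if b then T else S))"
    using assms(1,2) by (intro gf_UN) simp_all
  then show ?thesis
    by (simp add: UNIV_bool)
qed

lemma gf_image:
  assumes inj: "inj_on h S"
    and f: "\<And>x. x \<in> S \<Longrightarrow> f (h x) = a + f' x" and g: "\<And>x. x \<in> S \<Longrightarrow> g (h x) = b + g' x"
  shows "gf f g (h ` S) = fps_X ^ a * fps_const fps_X ^ b * gf f' g' S"
proof (intro fps_ext)
  fix k n
  have "card {x \<in> h ` S. f x = k \<and> g x = n} =
      (if k < a \<or> n < b then 0 else card {x \<in> S. f' x = k - a \<and> g' x = n - b})"
  proof (cases "k < a \<or> n < b")
    case True
    then have "{x \<in> h ` S. f x = k \<and> g x = n} = {}"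
      using f g by auto
    then show ?thesis
      using True by (simp only: card.empty if_True)
  next
    case False
    then have "{x \<in> h ` S. f x = k \<and> g x = n} = h ` {x \<in> S. f' x = k - a \<and> g' x = n - b}"
      using f g by auto
    moreover have "inj_on h {x \<in> S. f' x = k - a \<and> g' x = n - b}"
      using inj by (rule inj_on_subset) auto
    ultimately show ?thesis
      using False by (simp add: card_image)
  qed
  then show "fps_nth (fps_nth (gf f g (h ` S)) k) n =
      fps_nth (fps_nth (fps_X ^ a * fps_const fps_X ^ b * gf f' g' S) k) n"
    by (simp add: gf_nth mult.assoc fps_X_power_mult_nth fps_const_power)
qed


section \<open>Sequences of slacks\<close>

text \<open>
  Lowering all parts of colour \<^term>\<open>B\<close> by 1 turns the difference matrix into the 0/1 matrix
  \<open>gap\<close>, with 1 added in the rows of overlined parts; the restriction on the last part becomes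
  the difference condition against an additional part 0 of colour \<^term>\<open>A\<close>.
\<close>

definition gap :: "colour \<Rightarrow> colour \<Rightarrow> nat" where
  "gap c c' = of_bool (c \<noteq> U \<and> (c' = c \<or> c' = U))"

text \<open>
  A list of steps describes a partition from its smallest part upwards: a step consists of the
  colour of a part, whether it is overlined, and by how much the difference to the previous part
  exceeds the minimum.  Position \<open>m\<close> from the large end contributes \<open>m\<close> times its difference
  to the size, whence \<open>wt\<close>.
\<close>

type_synonym step = "colour \<times> bool \<times> nat"

fun wt :: "colour \<Rightarrow> step list \<Rightarrow> nat" where
  "wt c [] = 0"
| "wt c ((c', b, x) # ts) = Suc (length ts) * (gap c' c + of_bool b + x) + wt c' ts"

definition plain :: "step list \<Rightarrow> nat" where
  "plain ts = length (filter (\<lambda>s. \<not> fst (snd s)) ts)"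

text \<open>In \<open>rev ts\<close>, as in the partition itself, only the first \<open>N\<close> parts may be non-overlined.\<close>

definition steps :: "nat \<Rightarrow> (colour \<Rightarrow> nat) \<Rightarrow> step list set" where
  "steps N m = {ts. (\<forall>c. length (filter (\<lambda>s. fst s = c) ts) = m c) \<and>
     (\<forall>s \<in> set (drop N (rev ts)). fst (snd s))}"

text \<open>The head belongs to the smallest part, from which all others are measured; increasing
  its slack raises every part by 1.\<close>

fun bump :: "step list \<Rightarrow> step list" where
  "bump [] = []"
| "bump ((c, b, x) # ts) = (c, b, Suc x) # ts"

lemma UNIV_colour: "UNIV = {A, B, U}"
  using colour.exhaust by blast

lemma length_steps:
  assumes "ts \<in> steps N m"
  shows "length ts = m A + m B + m U"
proof -
  have "length ts = length (filter (\<lambda>s. fst s = A) ts) + length (filter (\<lambda>s. fst s = B) ts)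
      + length (filter (\<lambda>s. fst s = U) ts)"
  proof (induction ts)
    case (Cons s ts)
    then show ?case by (cases "fst s") auto
  qed simp
  then show ?thesis
    using assms by (simp add: steps_def)
qed

text \<open>The head lands at position \<open>length ts\<close> of the reversed list, counted from
  0.\<close>

lemma Cons_in_steps_iff:
  "(c, b, x) # ts \<in> steps N m \<longleftrightarrow>
     m c > 0 \<and> (b \<or> length ts < N) \<and> ts \<in> steps N (m(c := m c - 1))"
proof -
  have "(\<forall>s \<in> set (drop N (rev ts @ [(c, b, x)])). fst (snd s)) \<longleftrightarrow>
      (b \<or> length ts < N) \<and> (\<forall>s \<in> set (drop N (rev ts)). fst (snd s))"
    by (cases "length ts < N") (auto simp: Suc_diff_Suc)
  moreover have "(\<forall>c'. length (filter (\<lambda>s. fst s = c') ((c, b, x) # ts)) = m c') \<longleftrightarrow>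
      m c > 0 \<and> (\<forall>c'. length (filter (\<lambda>s. fst s = c') ts) = (m(c := m c - 1)) c')"
    by (auto split: if_splits)
  ultimately show ?thesis
    unfolding steps_def mem_Collect_eq rev.simps by blast
qed

lemma le_wt: "(c', b, x) \<in> set ts \<Longrightarrow> x \<le> wt c ts"
proof (induction ts arbitrary: c)
  case (Cons s ts)
  obtain c'' b' y where s: "s = (c'', b', y)"
    by (cases s)
  show ?case
  proof (cases "(c', b, x) = s")
    case True
    then show ?thesis
      by (simp add: s)
  next
    case False
    then have "x \<le> wt c'' ts"
      using Cons by auto
    then show ?thesis
      by (simp add: s)
  qed
qed simp

lemma finite_fibres_steps: "finite_fibres (wt c) (steps N m)"
  unfolding finite_fibres_def
proof
  fix n :: nat
  have "finite ((UNIV :: colour set) \<times> (UNIV :: bool set) \<times> {..n})"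
    by (simp add: UNIV_colour)
  from finite_lists_length_eq[OF this, of "m A + m B + m U"]
  show "finite {ts \<in> steps N m. wt c ts = n}"
    by (rule rev_finite_subset) (auto simp: length_steps le_wt)
qed

lemma inj_bump: "inj bump"
proof (rule injI)
  fix ts us show "bump ts = bump us \<Longrightarrow> ts = us"
    by (cases ts rule: bump.cases; cases us rule: bump.cases) auto
qed

text \<open>If the smallest part has slack 0, it can be removed; otherwise its slack can be lowered
  by 1.\<close>

lemma steps_decompose:
  assumes "m A + m B + m U > 0"
  shows "steps N m =
    (\<Union>(c', b) \<in> {(c', b). m c' > 0 \<and> (b \<or> m A + m B + m U \<le> N)}.
       (#) (c', b, 0) ` steps N (m(c' := m c' - 1))) \<union> bump ` steps N m"
    (is "_ = ?T \<union> _")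
proof (intro equalityI subsetI)
  fix ts assume ts: "ts \<in> steps N m"
  then obtain c' b x us where eq: "ts = (c', b, x) # us"
    using assms length_steps[OF ts] by (cases ts) auto
  show "ts \<in> ?T \<union> bump ` steps N m"
  proof (cases x)
    case 0
    have "m c' > 0 \<and> (b \<or> m A + m B + m U \<le> N)"
      and "ts \<in> (#) (c', b, 0) ` steps N (m(c' := m c' - 1))"
      using ts length_steps[OF ts] unfolding eq 0 Cons_in_steps_iff by auto
    then show ?thesis
      by blast
  next
    case (Suc y)
    then have "ts = bump ((c', b, y) # us)" "(c', b, y) # us \<in> steps N m"
      using ts by (simp_all add: eq Cons_in_steps_iff)
    then show ?thesis by blast
  qed
next
  fix ts assume "ts \<in> ?T \<union> bump ` steps N m"
  then show "ts \<in> steps N m"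
  proof
    assume "ts \<in> ?T"
    then obtain c' b us where *: "m c' > 0" "b \<or> m A + m B + m U \<le> N"
      "us \<in> steps N (m(c' := m c' - 1))" "ts = (c', b, 0) # us"
      by auto
    have "length us < m A + m B + m U"
      using length_steps[OF *(3)] *(1) by (cases c') auto
    then show ?thesis
      using * by (auto simp: Cons_in_steps_iff)
  next
    assume "ts \<in> bump ` steps N m"
    then obtain us where "us \<in> steps N m" "ts = bump us"
      by blast
    then show ?thesis
      by (cases us rule: bump.cases) (auto simp: Cons_in_steps_iff)
  qed
qed

definition GF :: "nat \<Rightarrow> colour \<Rightarrow> (colour \<Rightarrow> nat) \<Rightarrow> rat fps fps" where
  "GF N c m = gf plain (wt c) (steps N m)"

text \<open>Bumping adds L to the weight, which gives the factor \<open>1 - q^L\<close>. A smallest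
  part with slack 0 lifts all L parts by its gap. Overlining lifts them once more, giving
  \<open>q^L\<close>; otherwise the part contributes d, allowed only for L \<le> N.\<close>

lemma GF_recurrence:
  fixes m N
  defines "L \<equiv> m A + m B + m U"
  assumes L: "L > 0"
  shows "(1 - fps_const fps_X ^ L) * GF N c m =
    ((if L \<le> N then fps_X else 0) + fps_const fps_X ^ L) *
    (\<Sum>c'\<in>{A, B, U}. fps_const fps_X ^ (L * gap c' c) *
       (if m c' = 0 then 0 else GF N c' (m(c' := m c' - 1))))"
proof -
  define q :: "rat fps fps" where "q = fps_const fps_X"
  define I where "I = {(c', b). m c' > 0 \<and> (b \<or> L \<le> N)}"
  define S where "S = (\<lambda>(c', b). (#) (c', b, 0) ` steps N (m(c' := m c' - 1)))"
  define F where "F = (\<lambda>(c', b). fps_X ^ of_bool (\<not> b) * q ^ (L * (gap c' c + of_bool b)) *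
    GF N c' (m(c' := m c' - 1)))"
  have dec: "steps N m = (\<Union>p\<in>I. S p) \<union> bump ` steps N m"
    using steps_decompose[of m N] L by (simp add: I_def S_def L_def)
  have fin: "finite (UNIV :: (colour \<times> bool) set)"
    by (metis UNIV_Times_UNIV UNIV_colour finite finite.emptyI finite.insertI finite_cartesian_product)
  have S_fib: "finite_fibres (wt c) (S p)" if "p \<in> I" for p
    using that by (intro finite_fibres_subset[OF finite_fibres_steps[of c N m]]) (subst dec, blast)
  have gfS: "gf plain (wt c) (S p) = F p" if p: "p \<in> I" for p
  proof -
    obtain c' b where p': "p = (c', b)"
      by (cases p)
    have len: "Suc (length ts) = L" if "ts \<in> steps N (m(c' := m c' - 1))" for ts
      using length_steps[OF that] p by (cases c') (auto simp: L_def I_def p')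
    show ?thesis
      unfolding p' S_def F_def q_def GF_def prod.case
      by (rule gf_image) (auto simp: inj_on_def plain_def len)
  qed
  have bump: "gf plain (wt c) (bump ` steps N m) = fps_X ^ 0 * fps_const fps_X ^ L * GF N c m"
    unfolding GF_def
  proof (rule gf_image)
    show "inj_on bump (steps N m)"
      using inj_bump by (rule inj_on_subset) simp
  next
    fix ts assume ts: "ts \<in> steps N m"
    show "plain (bump ts) = 0 + plain ts"
      by (cases ts rule: bump.cases) (auto simp: plain_def)
    show "wt c (bump ts) = L + wt c ts"
      using length_steps[OF ts] L
      by (cases ts rule: bump.cases) (auto simp: L_def algebra_simps)
  qed
  have "gf plain (wt c) ((\<Union>p\<in>I. S p) \<union> bump ` steps N m) = gf plain (wt c) (\<Union>p\<in>I. S p) + gf plain (wt c) (bump ` steps N m)"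
  proof (rule gf_Un)
    have "bump us \<noteq> (c', b, 0) # ts" for us c' b ts
      by (cases us rule: bump.cases) simp_all
    from this this[symmetric] show "(\<Union>p\<in>I. S p) \<inter> bump ` steps N m = {}"
      by (auto simp: S_def)
  qed (use dec in \<open>blast intro: finite_fibres_subset[OF finite_fibres_steps[of c N m]]\<close>)+
  then have split: "GF N c m = gf plain (wt c) (\<Union>p\<in>I. S p) + q ^ L * GF N c m"
    unfolding dec[symmetric] bump GF_def[symmetric] q_def by simp
  have "gf plain (wt c) (\<Union>p\<in>I. S p) = (\<Sum>p\<in>I. F p)"
  proof -
    have "S p \<inter> S p' = {}" if "p \<noteq> p'" for p p'
      using that by (auto simp: S_def)
    then have "gf plain (wt c) (\<Union>p\<in>I. S p) = (\<Sum>p\<in>I. gf plain (wt c) (S p))"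
      using S_fib finite_subset[OF subset_UNIV fin] by (intro gf_UN)
    then show ?thesis
      using gfS by simp
  qed
  also have "(\<Sum>p\<in>I. F p) = (\<Sum>p\<in>UNIV. if p \<in> I then F p else 0)"
    using fin by (simp add: sum.If_cases)
  also have "\<dots> = (\<Sum>c'\<in>UNIV. \<Sum>b\<in>UNIV. if (c', b) \<in> I then F (c', b) else 0)"
    by (simp only: UNIV_Times_UNIV[symmetric] sum.cartesian_product)
      (auto intro: sum.cong)
  also have "\<dots> = (\<Sum>c'\<in>{A, B, U}. ((if L \<le> N then fps_X else 0) + q ^ L) *
      (q ^ (L * gap c' c) * (if m c' = 0 then 0 else GF N c' (m(c' := m c' - 1)))))"
    unfolding UNIV_colour by (rule sum.cong)
      (auto simp: UNIV_bool I_def F_def algebra_simps power_add)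
  also have "\<dots> = ((if L \<le> N then fps_X else 0) + q ^ L) *
      (\<Sum>c'\<in>{A, B, U}. q ^ (L * gap c' c) *
        (if m c' = 0 then 0 else GF N c' (m(c' := m c' - 1))))"
    by (rule sum_distrib_left[symmetric])
  finally have eq: "gf plain (wt c) (\<Union>p\<in>I. S p) = \<dots>" .
  have "x = y + z * x \<Longrightarrow> (1 - z) * x = y" for x y z :: "rat fps fps"
    by algebra
  from this[OF split] show ?thesis
    unfolding eq q_def .
qed

lemma GF_zero: "GF N c (case_colour 0 0 0) = 1"
proof -
  have "steps N (case_colour 0 0 0) = {[]}"
  proof (intro equalityI subsetI)
    fix ts assume "ts \<in> steps N (case_colour 0 0 0)"
    from length_steps[OF this] show "ts \<in> {[]}"
      by simp
  qed (simp add: steps_def split: colour.split)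
  moreover have "{ts \<in> {[]}. plain ts = k \<and> wt c ts = n} = (if k = 0 \<and> n = 0 then {[]} else {})"
    for k n by (auto simp: plain_def)
  ultimately show ?thesis
    by (intro fps_ext) (simp add: GF_def gf_nth)
qed

lemma case_colour_upd:
  "(case_colour i j t)(A := i') = case_colour i' j t"
  "(case_colour i j t)(B := j') = case_colour i j' t"
  "(case_colour i j t)(U := t') = case_colour i j t'"
  by (simp_all add: fun_eq_iff split: colour.split)

text \<open>Only the conjunct for \<open>FA\<close> is kept: \<open>A\<close> is the colour of the
  additional part 0 below the sequence.\<close>

lemma GF_closed_form:
  fixes q :: "rat fps fps"
  defines "q \<equiv> fps_const fps_X"
  shows "qpoch q q t * qpoch (q\<^sup>2) (q\<^sup>2) i * qpoch (q\<^sup>2) (q\<^sup>2) j * q ^ j *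
      GF N A (case_colour i j t) =
    q ^ expo i j * qpoch (- q) q (i + j) *
      (\<Prod>n<i + j + t. (if n < N then fps_X else 0) + q ^ Suc n)"
proof -
  have nth: "fps_nth (fps_nth (q ^ n) 0) k = (if k = n then 1 else 0)" for n k
    by (simp add: q_def fps_const_power)
  have q0: "q \<noteq> 0"
    by (simp add: q_def)
  have q1: "q ^ n \<noteq> 1" if "n > 0" for n
  proof
    assume "q ^ n = 1"
    then show False
      using nth[of n 0] that by simp
  qed
  have qm1: "1 + q ^ n \<noteq> 0" for n
  proof
    assume "1 + q ^ n = 0"
    then have "fps_nth (fps_nth (1 + q ^ n) 0) 0 = 0"
      by simp
    then show False
      by (simp add: nth split: if_splits)
  qed
  \<comment> \<open>The contribution of the part at position n + 1 from the large end: d if not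
    overlined, \<open>q^(n+1)\<close> if overlined.\<close>
  define h where "h = (\<lambda>n. (if n < N then fps_X else 0) + q ^ Suc n)"
  have rec: "(1 - q ^ (i + j + t)) * GF N c (case_colour i j t) = h (i + j + t - 1) *
      (q ^ ((i + j + t) * gap A c) * (if i = 0 then 0 else GF N A (case_colour (i - 1) j t)) +
       q ^ ((i + j + t) * gap B c) * (if j = 0 then 0 else GF N B (case_colour i (j - 1) t)) +
       q ^ ((i + j + t) * gap U c) * (if t = 0 then 0 else GF N U (case_colour i j (t - 1))))"
    if pos: "i + j + t > 0" for c i j t
  proof -
    obtain n where n: "i + j + t = Suc n"
      using pos gr0_conv_Suc by blast
    have h: "h (i + j + t - 1) = (if i + j + t \<le> N then fps_X else 0) + q ^ (i + j + t)"
      unfolding n by (simp add: h_def Suc_le_eq)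
    have sum3: "(\<Sum>c'\<in>{A, B, U}. f c') = f A + f B + f U" for f :: "colour \<Rightarrow> rat fps fps"
      by (simp add: add.assoc)
    have "0 < case_colour i j t A + case_colour i j t B + case_colour i j t U"
      using pos by simp
    from GF_recurrence[OF this, of N c] show ?thesis
      unfolding q_def[symmetric] sum3 colour.case case_colour_upd h .
  qed
  show ?thesis
    unfolding h_def[symmetric]
    by (rule word_recurrence_closed_form[where q = q and h = h
        and FA = "\<lambda>i j t. GF N A (case_colour i j t)" and FB = "\<lambda>i j t. GF N B (case_colour i j t)"
        and FU = "\<lambda>i j t. GF N U (case_colour i j t)", THEN conjunct1, OF q0 q1 qm1 GF_zero GF_zero GF_zero])
      (assumption | (subst rec, assumption, simp add: gap_def))+
qed


section \<open>Jagged overpartitions as sequences of slacks\<close>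

text \<open>The list runs upwards from the smallest part; \<open>c\<close> and \<open>v\<close> are
  colour and lowered value of the previous part. The summand for colour \<open>B\<close> undoes the
  lowering of \<open>p\<close>.\<close>

fun chain :: "colour \<Rightarrow> nat \<Rightarrow> part list \<Rightarrow> bool" where
  "chain c v [] \<longleftrightarrow> True"
| "chain c v (p # ps) \<longleftrightarrow>
     v + gap (colour p) c + of_bool (overlined p) + of_bool (colour p = B) \<le> val p \<and>
     chain (colour p) (val p - of_bool (colour p = B)) ps"

text \<open>A check of all 36 matrix entries; the last two terms come from lowering the parts of
  colour \<open>B\<close>.\<close>

lemma min_diff_eq:
  "min_diff p p' = int (gap (colour p) (colour p')) + of_bool (overlined p)
     + of_bool (colour p = B) - of_bool (colour p' = B)"
  by (cases p rule: type_index.cases; cases p' rule: type_index.cases)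
    (simp_all add: min_diff_def diff_matrix_def gap_def)

text \<open>Lowered values never decrease along a chain, and the step to an overlined part is
  strict.\<close>

lemma chain_bound:
  "chain c v ps \<Longrightarrow> p \<in> set ps \<Longrightarrow> v + of_bool (overlined p) + of_bool (colour p = B) \<le> val p"
proof (induction ps arbitrary: c v)
  case (Cons p' ps)
  show ?case
  proof (cases "p = p'")
    case True
    then show ?thesis
      using Cons.prems by simp
  next
    case False
    then have "p \<in> set ps"
      using Cons.prems(2) by simp
    moreover have "chain (colour p') (val p' - of_bool (colour p' = B)) ps"
      using Cons.prems(1) by simp
    ultimately have "val p' - of_bool (colour p' = B) + of_bool (overlined p)
        + of_bool (colour p = B) \<le> val p"
      by (rule Cons.IH[rotated])
    moreover have "v + of_bool (colour p' = B) \<le> val p'"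
      using Cons.prems(1) by simp
    ultimately show ?thesis
      by linarith
  qed
qed simp

lemma chain_iff_successively:
  "chain c v ps \<longleftrightarrow>
     (ps \<noteq> [] \<longrightarrow> v + gap (colour (hd ps)) c + of_bool (overlined (hd ps))
        + of_bool (colour (hd ps) = B) \<le> val (hd ps)) \<and>
     successively (\<lambda>p' p. int (val p) - int (val p') \<ge> min_diff p p') ps"
proof (induction ps arbitrary: c v)
  case (Cons p ps)
  show ?case
  proof (cases ps)
    case (Cons p' ps')
    \<comment> \<open>The assumption, which holds in a chain, keeps the subtraction from being
      truncated.\<close>
    have "val p - of_bool (colour p = B) + gap (colour p') (colour p) + of_bool (overlined p')
          + of_bool (colour p' = B) \<le> val p' \<longleftrightarrow> int (val p') - int (val p) \<ge> min_diff p' p"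
      if "of_bool (colour p = B) \<le> val p"
      using that by (simp add: min_diff_eq of_bool_def split: if_splits) linarith+
    then show ?thesis
      unfolding chain.simps(2) Cons.IH using Cons by auto
  qed simp
qed simp

text \<open>The restriction on the last part is the first link of the chain, and both conditions on
  overlining follow from \<open>chain_bound\<close>.\<close>

lemma jagged_overpartition_iff:
  "jagged_overpartition n ps \<longleftrightarrow> sum_list (map val ps) = n \<and> chain A 0 (rev ps)"
proof -
  let ?final = "\<lambda>p p'. overlined p \<longrightarrow> \<not> (val p = val p' \<and> colour p = colour p')"
  let ?adj = "\<lambda>p p'. int (val p) - int (val p') \<ge> min_diff p p'"
  let ?bad = "{Part 0 A False, Part 0 B False, Part 1 A True, Part 1 B True}"
  let ?link = "0 + gap (colour (hd (rev ps))) A + of_bool (overlined (hd (rev ps)))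
    + of_bool (colour (hd (rev ps)) = B) \<le> val (hd (rev ps))"
  have sorted: "(\<forall>i j. i < j \<and> j < length ps \<and> overlined (ps ! i) \<longrightarrow>
        \<not> (val (ps ! i) = val (ps ! j) \<and> colour (ps ! i) = colour (ps ! j))) \<longleftrightarrow>
      sorted_wrt ?final ps"
    unfolding sorted_wrt_iff_nth_less by blast
  have adj: "(\<forall>i. Suc i < length ps \<longrightarrow> ?adj (ps ! i) (ps ! Suc i)) \<longleftrightarrow>
      successively (\<lambda>p' p. ?adj p p') (rev ps)"
    unfolding successively_rev by (simp only: successively_conv_nth)
  have chain: "chain A 0 (rev ps) \<longleftrightarrow>
      (ps \<noteq> [] \<longrightarrow> ?link) \<and> successively (\<lambda>p' p. ?adj p p') (rev ps)"
    unfolding chain_iff_successively rev_is_Nil_conv ..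
  have "chain c v qs \<Longrightarrow> sorted_wrt (\<lambda>p' p. ?final p p') qs" for c v qs
  proof (induction qs arbitrary: c v)
    case (Cons q qs)
    \<comment> \<open>Parts of equal colour are lowered equally, so an overlined \<open>p\<close> of
      the colour of \<open>q\<close> has strictly larger value.\<close>
    have "?final p q" if "p \<in> set qs" for p
      using chain_bound[OF _ that, of "colour q" "val q - of_bool (colour q = B)"] Cons.prems
      by (auto simp: of_bool_def split: if_splits)
    then show ?case
      using Cons by auto
  qed simp
  from this[of A 0 "rev ps"] have final: "chain A 0 (rev ps) \<Longrightarrow> sorted_wrt ?final ps"
    by (simp add: sorted_wrt_rev)
  have pos: "chain A 0 (rev ps) \<Longrightarrow> \<forall>p \<in> set ps. overlined p \<longrightarrow> val p > 0"
    using chain_bound[of A 0 "rev ps"] by fastforce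
  \<comment> \<open>Overlined zeros are not in \<open>?bad\<close>; positivity excludes
    them.\<close>
  have last: "last ps \<notin> ?bad \<longleftrightarrow> ?link"
    if "ps \<noteq> []" "\<forall>p \<in> set ps. overlined p \<longrightarrow> val p > 0"
  proof -
    have "overlined (last ps) \<longrightarrow> val (last ps) > 0"
      using that by simp
    then show ?thesis
      unfolding hd_rev
      by (cases "last ps" rule: type_index.cases) (auto simp: gap_def)
  qed
  have propositional: "s \<and> p \<and> f \<and> (e \<longrightarrow> l) \<and> d \<longleftrightarrow> s \<and> c"
    if "c \<longleftrightarrow> (e \<longrightarrow> k) \<and> d" "c \<Longrightarrow> f" "c \<Longrightarrow> p" "e \<Longrightarrow> p \<Longrightarrow> l \<longleftrightarrow> k" for s p f e l d c k
    using that by blast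
  show ?thesis
    unfolding jagged_overpartition_def sorted adj
    by (rule propositional[OF chain final pos last])
qed

text \<open>Inverse to reading off the slacks of a chain. The running value is the lowered
  one.\<close>

fun parts_of :: "colour \<Rightarrow> nat \<Rightarrow> step list \<Rightarrow> part list" where
  "parts_of c v [] = []"
| "parts_of c v ((c', b, x) # ts) =
     Part (v + gap c' c + of_bool b + x + of_bool (c' = B)) c' b
       # parts_of c' (v + gap c' c + of_bool b + x) ts"

lemma chain_parts_of: "chain c v (parts_of c v ts)"
  by (induction ts arbitrary: c v) auto

lemma chain_imp_parts_of: "chain c v ps \<Longrightarrow> \<exists>ts. ps = parts_of c v ts"
proof (induction ps arbitrary: c v)
  case Nil
  show ?case
    by (rule exI[of _ "[]"]) simp
next
  case (Cons p ps)
  define x where "x = val p - (v + gap (colour p) c + of_bool (overlined p) + of_bool (colour p = B))"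
  have val: "val p = v + gap (colour p) c + of_bool (overlined p) + x + of_bool (colour p = B)"
    using Cons.prems by (simp add: x_def)
  then have "chain (colour p) (v + gap (colour p) c + of_bool (overlined p) + x) ps"
    using Cons.prems by simp
  from Cons.IH[OF this] obtain ts
    where "ps = parts_of (colour p) (v + gap (colour p) c + of_bool (overlined p) + x) ts"
    by blast
  then have "p # ps = parts_of c v ((colour p, overlined p, x) # ts)"
    using val by (cases p) simp
  then show ?case
    by blast
qed

lemma parts_of_eq_iff: "parts_of c v ts = parts_of c v us \<longleftrightarrow> ts = us"
proof (induction ts arbitrary: c v us)
  case Nil
  show ?case
    by (cases "(c, v, us)" rule: parts_of.cases) auto
next
  case (Cons s ts)
  show ?case
    by (cases s; cases "(c, v, us)" rule: parts_of.cases) (auto simp: Cons.IH)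
qed

lemma length_parts_of [simp]: "length (parts_of c v ts) = length ts"
  by (induction ts arbitrary: c v) auto

lemma num_colour_parts_of:
  "num_colour c' (parts_of c v ts) = length (filter (\<lambda>s. fst s = c') ts)"
  by (induction ts arbitrary: c v) (auto simp: num_colour_def)

lemma map_overlined_parts_of: "map overlined (parts_of c v ts) = map (\<lambda>s. fst (snd s)) ts"
  by (induction ts arbitrary: c v) auto

lemma num_nonoverlined_parts_of: "num_nonoverlined (parts_of c v ts) = plain ts"
  by (induction ts arbitrary: c v) (auto simp: num_nonoverlined_def plain_def)

text \<open>The starting value \<open>v\<close> lifts every part, and each part of colour
  \<open>B\<close> regains the 1 by which it was lowered.\<close>

lemma sum_list_parts_of:
  "sum_list (map val (parts_of c v ts)) =
     v * length ts + wt c ts + length (filter (\<lambda>s. fst s = B) ts)"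
  by (induction ts arbitrary: c v) (auto simp: algebra_simps)

lemma overlined_drop_parts_of:
  "(\<forall>p \<in> set (drop N (rev (parts_of c v ts))). overlined p) \<longleftrightarrow>
     (\<forall>s \<in> set (drop N (rev ts)). fst (snd s))"
proof -
  have "overlined ` set (drop N (rev (parts_of c v ts))) =
      (\<lambda>s. fst (snd s)) ` set (drop N (rev ts))"
    by (simp only: set_map[symmetric] drop_map[symmetric] rev_map[symmetric] map_overlined_parts_of)
  then show ?thesis
    by (metis (no_types, lifting) image_iff)
qed

lemma num_colour_rev [simp]: "num_colour c (rev ps) = num_colour c ps"
  by (simp add: num_colour_def rev_filter[symmetric])

lemma num_nonoverlined_rev [simp]: "num_nonoverlined (rev ps) = num_nonoverlined ps"
  by (simp add: num_nonoverlined_def rev_filter[symmetric])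

text \<open>Overlining the final t parts leaves just the first i + j parts free, since i + j parts
  have colour a or b.\<close>

lemma rev_parts_of_in_C3_set_iff:
  "rev (parts_of A 0 ts) \<in> C3_set n k i j \<longleftrightarrow>
     (\<exists>t. ts \<in> steps (i + j) (case_colour i j t)) \<and> plain ts = k \<and> wt A ts + j = n"
proof -
  let ?m = "\<lambda>c. length (filter (\<lambda>s. fst s = c) ts)"
  have len: "length ts = ?m A + ?m B + ?m U"
    \<comment> \<open>With the bound \<open>length ts\<close> the condition on overlining is
      vacuous.\<close>
    by (rule length_steps[of _ "length ts"]) (simp add: steps_def)
  have "(\<exists>t. ts \<in> steps (i + j) (case_colour i j t)) \<longleftrightarrow>
      ?m A = i \<and> ?m B = j \<and> (\<forall>s \<in> set (drop (i + j) (rev ts)). fst (snd s))"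
    by (auto simp: steps_def split: colour.split)
  then show ?thesis
    using len
    by (auto simp: C3_set_def jagged_overpartition_iff chain_parts_of num_colour_parts_of
        num_nonoverlined_parts_of sum_list_parts_of overlined_drop_parts_of rev_map[symmetric])
qed

lemma length_le_sum_list: "\<forall>x \<in> set xs. 0 < x \<Longrightarrow> length xs \<le> sum_list (xs :: nat list)"
  by (induction xs) auto

text \<open>The final t parts are overlined, hence positive. This bounds the sum over t.\<close>

lemma num_colour_U_le:
  assumes "ps \<in> C3_set n k i j"
  shows "num_colour U ps \<le> n"
proof -
  define qs where "qs = drop (length ps - num_colour U ps) ps"
  have "num_colour U ps \<le> length ps"
    by (simp add: num_colour_def)
  then have "num_colour U ps = length (map val qs)"
    by (simp add: qs_def)
  also have "\<dots> \<le> sum_list (map val qs)"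
  proof (rule length_le_sum_list)
    have "overlined p" "p \<in> set ps" if "p \<in> set qs" for p
      using assms that by (auto simp: C3_set_def qs_def dest: in_set_dropD)
    then show "\<forall>x \<in> set (map val qs). 0 < x"
      using assms by (auto simp: C3_set_def jagged_overpartition_def)
  qed
  also have "\<dots> \<le> sum_list (map val (take (length ps - num_colour U ps) ps)) + sum_list (map val qs)"
    by simp
  also have "\<dots> = sum_list (map val ps)"
    by (metis append_take_drop_id map_append qs_def sum_list_append)
  also have "\<dots> = n"
    using assms by (simp add: C3_set_def jagged_overpartition_def)
  finally show ?thesis .
qed

text \<open>\<open>parts_of\<close> followed by reversal is a bijection, and the classes for
  different t are disjoint because t is the number of parts of colour u.\<close>

lemma C3_eq_sum:
  "C3 n k i j =
     (\<Sum>t\<le>n. card {ts \<in> steps (i + j) (case_colour i j t). plain ts = k \<and> wt A ts + j = n})"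
proof -
  define T where
    "T = (\<lambda>t. {ts \<in> steps (i + j) (case_colour i j t). plain ts = k \<and> wt A ts + j = n})"
  have U: "num_colour U (rev (parts_of A 0 ts)) = t" if "ts \<in> T t" for ts t
    using that by (simp add: T_def steps_def num_colour_parts_of)
  have "bij_betw (\<lambda>ts. rev (parts_of A 0 ts)) (\<Union>t\<le>n. T t) (C3_set n k i j)"
    unfolding bij_betw_def
  proof (intro conjI equalityI subsetI)
    show "inj_on (\<lambda>ts. rev (parts_of A 0 ts)) (\<Union>t\<le>n. T t)"
      by (simp add: inj_on_def parts_of_eq_iff)
  next
    fix ps assume "ps \<in> (\<lambda>ts. rev (parts_of A 0 ts)) ` (\<Union>t\<le>n. T t)"
    then show "ps \<in> C3_set n k i j"
      by (auto simp: T_def rev_parts_of_in_C3_set_iff)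
  next
    fix ps assume ps: "ps \<in> C3_set n k i j"
    then have "chain A 0 (rev ps)"
      by (simp add: C3_set_def jagged_overpartition_iff)
    then obtain ts where "rev ps = parts_of A 0 ts"
      using chain_imp_parts_of by blast
    then have eq: "ps = rev (parts_of A 0 ts)"
      by (metis rev_rev_ident)
    then obtain t where t: "ts \<in> T t"
      using ps rev_parts_of_in_C3_set_iff by (auto simp: T_def)
    have "t \<le> n"
      using num_colour_U_le[OF ps] U[OF t] by (simp add: eq)
    then show "ps \<in> (\<lambda>ts. rev (parts_of A 0 ts)) ` (\<Union>t\<le>n. T t)"
      using t eq by blast
  qed
  then have "C3 n k i j = card (\<Union>t\<le>n. T t)"
    unfolding C3_def by (rule bij_betw_same_card[symmetric])
  also have "\<dots> = (\<Sum>t\<le>n. card (T t))"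
  proof (rule card_UN_disjoint)
    show "\<forall>t\<in>{..n}. finite (T t)"
    proof
      fix t
      have "finite {ts \<in> steps (i + j) (case_colour i j t). wt A ts = n - j}"
        using finite_fibres_steps by (simp add: finite_fibres_def)
      then show "finite (T t)"
        by (rule rev_finite_subset) (auto simp: T_def)
    qed
    show "\<forall>t\<in>{..n}. \<forall>t'\<in>{..n}. t \<noteq> t' \<longrightarrow> T t \<inter> T t' = {}"
      using U by blast
  qed simp
  finally show ?thesis
    unfolding T_def .
qed


section \<open>Summation over the number of parts of colour u\<close>

lemma qpoch_fps_const: "qpoch (fps_const x) (fps_const q) n = fps_const (qpoch x q n)"
  by (induction n) (simp_all add: qpoch_Suc fps_const_power flip: fps_const_1_eq_1)

text \<open>For N = i + j the product in the closed form splits: the first N factors have the form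
  \<open>d + q^m\<close>, while the last t, from parts forced to be overlined, give the numerator of
  the Euler term.\<close>

lemma GF_eq_euler_term:
  fixes i j t :: nat
  defines "q \<equiv> fps_const fps_X :: rat fps fps"
  shows "q ^ j * GF (i + j) A (case_colour i j t) =
    fps_const (fps_X ^ expo i j * qpoch (- fps_X) fps_X (i + j) *
      inverse (qpoch (fps_X\<^sup>2) (fps_X\<^sup>2) i * qpoch (fps_X\<^sup>2) (fps_X\<^sup>2) j) * euler_term (i + j) t) *
    (\<Prod>m<i + j. fps_X + q ^ Suc m)"
proof -
  define N where "N = i + j"
  define R where "R = (\<Prod>m<N. fps_X + q ^ Suc m)"
  define P where "P = qpoch (fps_X\<^sup>2) (fps_X\<^sup>2) i * qpoch (fps_X\<^sup>2) (fps_X\<^sup>2 :: rat fps) j"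
  define E where "E = (\<Prod>m<t. fps_X ^ (N + Suc m) :: rat fps)"
  define Q where "Q = (qpoch fps_X fps_X t :: rat fps)"
  define M where "M = (fps_X ^ expo i j * qpoch (- fps_X) fps_X N :: rat fps)"
  have R: "(\<Prod>n<N + s. (if n < N then fps_X else 0) + q ^ Suc n) =
      R * fps_const (\<Prod>m<s. fps_X ^ (N + Suc m))" for s
  proof (induction s)
    case 0
    show ?case
      by (simp add: R_def)
  next
    case (Suc s)
    have "q ^ Suc (N + s) = fps_const (fps_X ^ (N + Suc s))"
      by (simp add: q_def fps_const_power del: power_Suc)
    then show ?case
      using Suc by (simp add: mult.assoc del: power_Suc)
  qed
  have Q: "Q * inverse Q = 1"
    unfolding Q_def by (rule inverse_mult_eq_1') simp
  have P: "P * inverse P = 1"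
    unfolding P_def by (rule inverse_mult_eq_1') simp
  have const: "qpoch q q t * qpoch (q\<^sup>2) (q\<^sup>2) i * qpoch (q\<^sup>2) (q\<^sup>2) j = fps_const (Q * P)"
    "q ^ expo i j * qpoch (- q) q N = fps_const M"
    by (simp_all add: q_def Q_def P_def M_def qpoch_fps_const fps_const_power mult.assoc)
  have "fps_const (Q * P) * (q ^ j * GF N A (case_colour i j t)) = fps_const M * (R * fps_const E)"
    using GF_closed_form[of t i j N] unfolding q_def[symmetric] const N_def[symmetric] R E_def
    by (simp only: const mult.assoc)
  also have "fps_const M * (R * fps_const E) = fps_const (M * E) * R"
    by (simp add: mult_ac flip: fps_const_mult)
  also have "M * E = Q * P * (M * inverse P * (E * inverse Q))"
    using P Q by (metis (no_types, lifting) mult.assoc mult.commute mult.right_neutral)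
  finally have "fps_const (Q * P) * (q ^ j * GF N A (case_colour i j t)) =
      fps_const (Q * P) * (fps_const (M * inverse P * (E * inverse Q)) * R)"
    by (simp only: mult.assoc fps_const_mult[symmetric])
  moreover have "Q * P \<noteq> 0"
    using P Q by auto
  ultimately have "q ^ j * GF N A (case_colour i j t) = fps_const (M * inverse P * (E * inverse Q)) * R"
    by simp
  then show ?thesis
    unfolding M_def P_def E_def Q_def R_def N_def euler_term_def .
qed

lemma C3_series:
  fixes i j :: nat
  defines "q \<equiv> fps_const fps_X :: rat fps fps"
  shows "series2 (\<lambda>k n. of_nat (C3 n k i j)) =
    fps_const (qpoch_inf (- fps_X) fps_X * fps_X ^ expo i j *
      inverse (qpoch (fps_X\<^sup>2) (fps_X\<^sup>2) i * qpoch (fps_X\<^sup>2) (fps_X\<^sup>2) j)) *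
    (\<Prod>m<i + j. fps_X + q ^ Suc m)"
proof (intro fps_ext)
  fix k n
  define N where "N = i + j"
  define R where "R = (\<Prod>m<i + j. fps_X + q ^ Suc m)"
  define I where "I = inverse (qpoch (fps_X\<^sup>2) (fps_X\<^sup>2) i * qpoch (fps_X\<^sup>2) (fps_X\<^sup>2 :: rat fps) j)"
  define u where "u = fps_X ^ expo i j * qpoch (- fps_X) fps_X N * I"
  have card: "of_nat (card {ts \<in> steps N (case_colour i j t). plain ts = k \<and> wt A ts + j = n}) =
      fps_nth (euler_term N t * (u * fps_nth R k)) n" for t
  proof -
    have "of_nat (card {ts \<in> steps N (case_colour i j t). plain ts = k \<and> wt A ts + j = n}) =
        fps_nth (fps_nth (q ^ j * GF N A (case_colour i j t)) k) n"
    proof (cases "n < j")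
      case True
      then have "{ts \<in> steps N (case_colour i j t). plain ts = k \<and> wt A ts + j = n} = {}"
        by auto
      then show ?thesis
        using True by (simp only: q_def fps_const_power fps_mult_left_const_nth
            fps_X_power_mult_nth card.empty of_nat_0 if_True)
    next
      case False
      then have "{ts \<in> steps N (case_colour i j t). plain ts = k \<and> wt A ts + j = n} =
          {ts \<in> steps N (case_colour i j t). plain ts = k \<and> wt A ts = n - j}"
        by auto
      then show ?thesis
        using False by (simp only: q_def fps_const_power fps_mult_left_const_nth
            fps_X_power_mult_nth GF_def gf_nth if_False)
    qed
    also have "q ^ j * GF N A (case_colour i j t) = fps_const (u * euler_term N t) * R"
      unfolding u_def I_def N_def R_def q_def by (rule GF_eq_euler_term)
    finally show ?thesis
      by (simp only: fps_mult_left_const_nth) (simp only: mult_ac)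
  qed
  have "fps_nth (fps_nth (series2 (\<lambda>k n. of_nat (C3 n k i j))) k) n = of_nat (C3 n k i j)"
    by (simp add: series2_def)
  also have "\<dots> = (\<Sum>t\<le>n. fps_nth (euler_term N t * (u * fps_nth R k)) n)"
    unfolding C3_eq_sum N_def[symmetric] of_nat_sum card ..
  also have "\<dots> = fps_nth ((\<Sum>t\<le>n. euler_term N t) * (u * fps_nth R k)) n"
    by (simp only: sum_distrib_right fps_sum_nth)
  also have "\<dots> = fps_nth (euler_sum N * (u * fps_nth R k)) n"
    by (rule sum_euler_term_mult_nth)
  \<comment> \<open>Summation over t has produced \<open>euler_sum N\<close>, which extends
    \<open>(-q;q)_N\<close> to the infinite product.\<close>
  also have "euler_sum N * (u * fps_nth R k) =
      (qpoch (- fps_X) fps_X N * euler_sum N) * fps_X ^ expo i j * I * fps_nth R k"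
    by (simp only: u_def mult_ac)
  also have "\<dots> = fps_nth (fps_const (qpoch_inf (- fps_X) fps_X * fps_X ^ expo i j * I) * R) k"
    by (simp only: qpoch_times_euler_sum qpoch_inf_eq_euler_sum fps_mult_left_const_nth)
  finally show "fps_nth (fps_nth (series2 (\<lambda>k n. of_nat (C3 n k i j))) k) n = fps_nth (fps_nth
      (fps_const (qpoch_inf (- fps_X) fps_X * fps_X ^ expo i j *
        inverse (qpoch (fps_X\<^sup>2) (fps_X\<^sup>2) i * qpoch (fps_X\<^sup>2) (fps_X\<^sup>2) j)) *
      (\<Prod>m<i + j. fps_X + q ^ Suc m)) k) n"
    unfolding I_def R_def .
qed

text \<open>Each factor is \<open>d + q^m = d * (1 + q^m / d)\<close>, which requires Laurent series
  in d.\<close>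

lemma fps_to_fls_prod_eq_qpoch:
  "fps_to_fls (\<Prod>m<n. fps_X + fps_const (x :: 'a::comm_ring_1) ^ Suc m) =
     fls_X ^ n * qpoch (- (fls_const x * fls_X_inv)) (fls_const x) n"
proof (induction n)
  case (Suc n)
  have "fls_X * (fls_const x * fls_X_inv) = (fls_const x :: 'a fls)"
    by (simp add: fls_X_times_conv_shift(1) fls_X_inv_times_conv_shift(2))
  then have "fps_to_fls (fps_X + fps_const x ^ Suc n) =
      fls_X * (1 - (- (fls_const x * fls_X_inv)) * fls_const x ^ n)"
    by (simp add: fps_to_fls_power fls_times_fps_to_fls distrib_left fls_const_power
        mult.assoc[symmetric] flip: fls_const_mult_const)
  then show ?case
    using Suc by (simp only: prod.lessThan_Suc fls_times_fps_to_fls qpoch_Suc power_Suc mult_ac)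
qed simp

lemma fps_const_mult_series2:
  "fps_const (fps_const c) * series2 F = series2 (\<lambda>i j. c * F i j :: 'a::semiring_1)"
  by (intro fps_ext) (simp add: series2_def fps_mult_left_const_nth)

theorem theorem1p7:
  shows "series2 (\<lambda>i j. fps_to_fls (series2 (\<lambda>k n. of_nat (C3 n k i j)))) =
    (fps_const (fps_const (fls_const (qpoch_inf (- fps_X) fps_X))) *
     series2 (\<lambda>r s.
       fls_const (fps_X ^ (r\<^sup>2 + r + s\<^sup>2 + s - (r + s + 1 choose 2))) *
       fls_X ^ (r + s) * qpoch (- (fls_const fps_X * fls_X_inv)) (fls_const fps_X) (r + s) *
       fls_const (1 / (qpoch (fps_X\<^sup>2) (fps_X\<^sup>2) r * qpoch (fps_X\<^sup>2) (fps_X\<^sup>2) s)))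
     :: abdq_series)"
proof -
  \<comment> \<open>The infinite product is free of a and b, so it suffices to compare the
    coefficients of \<open>a^r b^s\<close>.\<close>
  have "fps_to_fls (series2 (\<lambda>k n. of_nat (C3 n k r s)) :: rat fps fps) =
      fls_const (qpoch_inf (- fps_X) fps_X) *
      (fls_const (fps_X ^ (r\<^sup>2 + r + s\<^sup>2 + s - (r + s + 1 choose 2))) * fls_X ^ (r + s) *
        qpoch (- (fls_const fps_X * fls_X_inv)) (fls_const fps_X) (r + s) *
        fls_const (1 / (qpoch (fps_X\<^sup>2) (fps_X\<^sup>2) r * qpoch (fps_X\<^sup>2) (fps_X\<^sup>2) s)))" for r s
  proof -
    \<comment> \<open>The denominator has constant term 1 and is therefore a unit.\<close>
    have inv: "1 / (qpoch (fps_X\<^sup>2) (fps_X\<^sup>2) r * qpoch (fps_X\<^sup>2) (fps_X\<^sup>2) s) =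
        inverse (qpoch (fps_X\<^sup>2) (fps_X\<^sup>2) r * qpoch (fps_X\<^sup>2) (fps_X\<^sup>2 :: rat fps) s)"
      by (simp add: fps_divide_unit)
    show ?thesis
      unfolding C3_series fls_times_fps_to_fls fps_to_fls_prod_eq_qpoch fps_const_to_fls
        fls_const_mult_const[symmetric] inv expo_def[symmetric]
      by (simp only: mult_ac)
  qed
  then show ?thesis
    unfolding fps_const_mult_series2 by simp
qed

end
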